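(* For integers $r\ge d\ge 2$, let $\rho$ denote the remainder of the division of $r$ by $d$. Then $$ \beta_r(d) \ge \left( \left\lfloor\frac{r}{d}\right\rfloor+1 \right)^{d-\rho} \left( \left\lfloor\frac{r}{d}\right\rfloor+2\right)^{\rho}. $$ Consequently, $$ \beta_r(d)>(r/d)^d, $$ and if $d\ge r/2$, then $$ \beta_r(d) \ge \left(\frac32\right)^r \left(\frac43\right)^d. $$
   Context: Let $\mathbb{F}_2^r$ be the $r$-dimensional vector space over the two-element field, and let $0\le d\le r$ be an integer. A subset $B\subseteq\mathbb{F}_2^r$ is called $d$-non-blocking if for every $v\in\mathbb{F}_2^r$ there exists a linear subspace $L_v\le\mathbb{F}_2^r$ of codimension $d$ (that is, of dimension $r-d$) such that $(v+(L_v\setminus\{0\}))\cap B=\varnothing$. By $\beta_r(d)$ we denote the largest possible size of a $d$-non-blocking subset of $\mathbb{F}_2^r$. *)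

theory Defs
  imports "HOL-Analysis.Analysis" "HOL-Library.Z2"
begin

text \<open>
  The space of dimension \<open>r\<close> over the two-element field is \<^typ>\<open>bit ^ 'r\<close> with
  \<open>r = CARD('r)\<close>. Subspaces and dimensions are those of the \<^typ>\<open>bit\<close>-vector space
  structure (prefix \<open>vec\<close>), not of a real vector space.
\<close>

definition non_blocking :: "nat \<Rightarrow> (bit ^ 'r::finite) set \<Rightarrow> bool" where
  "non_blocking d B \<longleftrightarrow>
    (\<forall>v. \<exists>L. vec.subspace L \<and> vec.dim L + d = CARD('r) \<and>
      (\<lambda>x. v + x) ` (L - {0}) \<inter> B = {})"

text \<open>
  The maximum below is taken over a finite nonempty set whenever \<open>d \<le> CARD('r)\<close>
  (see \<open>max_non_blocking_attained\<close>). For \<open>d > CARD('r)\<close> no set is \<open>d\<close>-non-blocking, and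
  the value is meaningless.
\<close>

definition max_non_blocking :: "'r::finite itself \<Rightarrow> nat \<Rightarrow> nat" (\<open>\<beta>\<close>) where
  "\<beta> (_ :: 'r itself) d = Max {card B | B :: (bit ^ 'r) set. non_blocking d B}"

instance bit :: finite
proof
  have "(UNIV :: bit set) = {0, 1}"
    by auto
  then show "finite (UNIV :: bit set)"
    by (metis finite.emptyI finite_insert)
qed

lemma finite_card_non_blocking:
  "finite {card B | B :: (bit ^ 'r::finite) set. non_blocking d B}"
  by simp

lemma non_blocking_empty:
  assumes "d \<le> CARD('r::finite)"
  shows "non_blocking d ({} :: (bit ^ 'r) set)"
proof -
  have "CARD('r) - d \<le> vec.dim (UNIV :: (bit ^ 'r) set)"
    unfolding vec_dim_card by simp
  then obtain L :: "(bit ^ 'r) set" where "vec.subspace L" "vec.dim L = CARD('r) - d"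
    using vec.choose_subspace_of_subspace by blast
  then show ?thesis
    using assms unfolding non_blocking_def by force
qed

lemma max_non_blocking_attained:
  assumes "d \<le> CARD('r::finite)"
  obtains B :: "(bit ^ 'r) set" where "non_blocking d B" "card B = \<beta> TYPE('r) d"
proof -
  have "{card B | B :: (bit ^ 'r) set. non_blocking d B} \<noteq> {}"
    using non_blocking_empty[OF assms] by blast
  then have "\<beta> TYPE('r) d \<in> {card B | B :: (bit ^ 'r) set. non_blocking d B}"
    unfolding max_non_blocking_def by (rule Max_in[OF finite_card_non_blocking])
  then show ?thesis
    using that by auto
qed

lemma card_le_max_non_blocking:
  fixes B :: "(bit ^ 'r::finite) set"
  assumes "non_blocking d B"
  shows "card B \<le> \<beta> TYPE('r) d"
  unfolding max_non_blocking_def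
  by (rule Max_ge[OF finite_card_non_blocking]) (use assms in blast)

end

theory Submission
  imports Defs
begin

text \<open>
  Split the coordinates into \<open>d\<close> blocks of sizes as equal as possible, and let \<open>B\<close> consist of
  the vectors having at most one nonzero coordinate in each block. If \<open>v \<in> B\<close>, one functional
  per block separates \<open>v\<close> from the rest of \<open>B\<close>: the coordinate at which \<open>v\<close> is nonzero, or the
  sum of the whole block if \<open>v\<close> vanishes there. If \<open>v \<notin> B\<close>, then two coordinates of \<open>v\<close> in one
  block equal \<open>1\<close>, and those two coordinates already separate \<open>v\<close> from \<open>B\<close>; this is where
  \<open>d \<ge> 2\<close> is needed.
\<close>

section \<open>Kernels of coordinate sums and a criterion for non-blocking sets\<close>

text \<open>If some \<open>s\<close> in \<open>S\<close> has \<open>f s \<noteq> 0\<close>,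
  subtracting a multiple of \<open>s\<close> moves any vector of \<open>S\<close> into the kernel,
  so \<open>s\<close> and the kernel part together span \<open>S\<close>.\<close>

lemma dim_subspace_inter_kernel:
  fixes S :: "('a::field ^ 'r::finite) set" and f :: "'a ^ 'r \<Rightarrow> 'a"
  assumes S: "vec.subspace S"
    and add: "\<And>x y. f (x + y) = f x + f y" and scale: "\<And>c x. f (c *s x) = c * f x"
  shows "vec.dim S \<le> vec.dim (S \<inter> {x. f x = 0}) + 1"
proof (cases "S \<subseteq> {x. f x = 0}")
  case True
  then show ?thesis
    by (simp add: Int_absorb2)
next
  case False
  then obtain s where s: "s \<in> S" "f s \<noteq> 0"
    by blast
  let ?K = "S \<inter> {x. f x = 0}"
  have "x \<in> vec.span (insert s ?K)" if "x \<in> S" for x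
  proof -
    define y where "y = x + (- (f x / f s)) *s s"
    have "y \<in> S"
      unfolding y_def using S s that by (intro vec.subspace_add vec.subspace_scale)
    moreover have "f y = 0"
      unfolding y_def add scale using s by simp
    ultimately have "y \<in> ?K" by simp
    then have "y + (f x / f s) *s s \<in> vec.span (insert s ?K)"
      by (intro vec.span_add vec.span_scale vec.span_base) auto
    moreover have "y + (f x / f s) *s s = x"
      unfolding y_def by (vector field_simps)
    ultimately show ?thesis by simp
  qed
  then have "vec.dim S \<le> vec.dim (insert s ?K)"
    by (metis subsetI vec.dim_mono)
  also have "\<dots> \<le> vec.dim ?K + 1"
    by (simp add: vec.dim_insert)
  finally show ?thesis .
qed

text \<open>Each functional costs at most one dimension. A functional is encoded by the set of
  coordinates it sums; over the two-element field every linear functional has this form.\<close>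

lemma subspace_and_dim_common_kernel:
  fixes \<A> :: "'r::finite set set"
  defines "L \<equiv> \<lambda>\<A>. {x :: 'a::field ^ 'r. \<forall>A\<in>\<A>. (\<Sum>k\<in>A. x $ k) = 0}"
  shows "vec.subspace (L \<A>) \<and> CARD('r) \<le> vec.dim (L \<A>) + card \<A>"
proof (induction \<A> rule: finite_induct[OF finite])
  case 1
  then show ?case
    unfolding L_def using vec_dim_card[where 'a = 'a and 'n = 'r] by (simp del: vec.dim_UNIV)
next
  case (2 A \<A>)
  have eq: "L (insert A \<A>) = L \<A> \<inter> {x. (\<Sum>k\<in>A. x $ k) = 0}"
    by (auto simp: L_def)
  have "vec.dim (L \<A>) \<le> vec.dim (L (insert A \<A>)) + 1"
    unfolding eq using 2
    by (intro dim_subspace_inter_kernel) (auto simp: sum.distrib sum_distrib_left)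
  moreover have "vec.subspace (L (insert A \<A>))"
    unfolding vec.subspace_def
    by (auto simp: L_def sum.distrib simp flip: sum_distrib_left)
  ultimately show ?case
    using 2 by simp
qed

text \<open>At most \<open>d\<close> functionals leave a common kernel of dimension at least
  \<open>CARD('r) - d\<close>. Passing to a subspace of exactly this dimension keeps the separation,
  so fewer than \<open>d\<close> functionals also do.\<close>

lemma non_blockingI:
  fixes B :: "(bit ^ 'r::finite) set"
  assumes "d \<le> CARD('r)"
    and sep: "\<And>v. \<exists>\<A>. card \<A> \<le> d \<and>
      (\<forall>x. (\<forall>A\<in>\<A>. (\<Sum>k\<in>A. x $ k) = 0) \<and> v + x \<in> B \<longrightarrow> x = 0)"
  shows "non_blocking d B"
  unfolding non_blocking_def
proof
  fix v
  obtain \<A> where \<A>: "card \<A> \<le> d"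
    "\<And>x. (\<forall>A\<in>\<A>. (\<Sum>k\<in>A. x $ k) = 0) \<Longrightarrow> v + x \<in> B \<Longrightarrow> x = 0"
    using sep[of v] by blast
  let ?K = "{x :: bit ^ 'r. \<forall>A\<in>\<A>. (\<Sum>k\<in>A. x $ k) = 0}"
  have K: "vec.subspace ?K" "CARD('r) \<le> vec.dim ?K + card \<A>"
    using subspace_and_dim_common_kernel by blast+
  then have "CARD('r) - d \<le> vec.dim ?K"
    using \<A>(1) by linarith
  then obtain L where L: "vec.subspace L" "L \<subseteq> vec.span ?K" "vec.dim L = CARD('r) - d"
    using vec.choose_subspace_of_subspace by blast
  then have "L \<subseteq> ?K"
    using K(1) by (simp add: vec.span_eq_iff[THEN iffD2])
  then have "(\<lambda>x. v + x) ` (L - {0}) \<inter> B = {}"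
    using \<A>(2) by blast
  with L assms(1) show "\<exists>L. vec.subspace L \<and> vec.dim L + d = CARD('r) \<and>
      (\<lambda>x. v + x) ` (L - {0}) \<inter> B = {}"
    by force
qed

section \<open>Vectors with at most one nonzero coordinate per block\<close>

text \<open>The blocks are the fibres of the labelling \<open>c\<close>; a label with empty fibre is
  an empty block.\<close>

definition block_sparse :: "('r \<Rightarrow> nat) \<Rightarrow> (bit ^ 'r::finite) set" where
  "block_sparse c = {x. \<forall>k l. c k = c l \<longrightarrow> x $ k = 1 \<longrightarrow> x $ l = 1 \<longrightarrow> k = l}"

lemma non_blocking_block_sparse:
  fixes c :: "'r::finite \<Rightarrow> nat"
  assumes c: "\<And>k. c k < d" and d: "2 \<le> d" "d \<le> CARD('r)"
  shows "non_blocking d (block_sparse c)"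
proof (rule non_blockingI[OF d(2)])
  fix v :: "bit ^ 'r"
  show "\<exists>\<A>. card \<A> \<le> d \<and>
    (\<forall>x. (\<forall>A\<in>\<A>. (\<Sum>k\<in>A. x $ k) = 0) \<and> v + x \<in> block_sparse c \<longrightarrow> x = 0)"
  proof (cases "v \<in> block_sparse c")
    case False
    then obtain k l where kl: "c k = c l" "v $ k = 1" "v $ l = 1" "k \<noteq> l"
      by (auto simp: block_sparse_def)
    show ?thesis
    \<comment> \<open>If \<open>x\<close> vanishes at \<open>k\<close> and \<open>l\<close>, then
      \<open>v + x\<close> still has two ones in one block, so it is never sparse.\<close>
    proof (intro exI[of _ "{{k}, {l}}"] conjI allI impI)
      show "card {{k}, {l}} \<le> d"
        using kl(4) d(1) by simp
      fix x :: "bit ^ 'r"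
      assume "(\<forall>A\<in>{{k}, {l}}. (\<Sum>k\<in>A. x $ k) = 0) \<and> v + x \<in> block_sparse c"
      then show "x = 0"
        using kl by (auto simp: block_sparse_def)
    qed
  next
    case True
    \<comment> \<open>For sparse \<open>v\<close> the first alternative is a singleton; the second
      sums the whole block.\<close>
    define A where "A i = (if \<exists>k. c k = i \<and> v $ k = 1 then {k. c k = i \<and> v $ k = 1}
      else {k. c k = i})" for i
    show ?thesis
    proof (intro exI[of _ "A ` {..<d}"] conjI allI impI)
      show "card (A ` {..<d}) \<le> d"
        using card_image_le[of "{..<d}" A] by simp
      fix x :: "bit ^ 'r"
      assume x: "(\<forall>A\<in>A ` {..<d}. (\<Sum>k\<in>A. x $ k) = 0) \<and> v + x \<in> block_sparse c"
      have sum0: "(\<Sum>j\<in>A (c k). x $ j) = 0" for k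
        using x c by blast
      have uniq: "k = l" if "c k = c l" "(v + x) $ k = 1" "(v + x) $ l = 1" for k l
        using x that unfolding block_sparse_def by blast
      have "x $ k \<noteq> 1" for k
      proof
        assume k: "x $ k = 1"
        show False
        proof (cases "\<exists>j. c j = c k \<and> v $ j = 1")
          case True
          then obtain j where j: "c j = c k" "v $ j = 1"
            by blast
          have one: "l = j" if "c l = c k" "v $ l = 1" for l
            using \<open>v \<in> block_sparse c\<close> j that unfolding block_sparse_def by auto
          then have "{l. c l = c k \<and> v $ l = 1} = {j}"
            using j by blast
          then have "A (c k) = {j}"
            unfolding A_def if_P[OF True] .
          then have "x $ j = 0"
            using sum0[of k] by simp
          \<comment> \<open>The one of \<open>v\<close> at \<open>j\<close> survives in
            \<open>v + x\<close>, and \<open>x\<close> adds a second one at \<open>k\<close> in the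
            same block.\<close>
          then have "j \<noteq> k" "(v + x) $ j = 1"
            using k j by auto
          moreover have "v $ k = 0"
            using one[of k] \<open>j \<noteq> k\<close> by (metis bit_not_one_iff)
          ultimately show False
            using uniq[of j k] j k by simp
        next
          case False
          then have v0: "v $ j = 0" if "c j = c k" for j
            using that by (metis bit_not_one_iff)
          \<comment> \<open>On this block \<open>v + x\<close> agrees with \<open>x\<close>, so
            \<open>k\<close> is the only one of \<open>x\<close> there and the block sum is 1, not
            0.\<close>
          have "x $ j = 0" if "c j = c k" "j \<noteq> k" for j
          proof (rule ccontr)
            assume "x $ j \<noteq> 0"
            then have "(v + x) $ j = 1" "(v + x) $ k = 1"
              using v0[of j] v0[of k] that k by simp_all
            then show False
              using uniq[of j k] that by blast
          qed
          then have "(\<Sum>j | c j = c k. x $ j) = (\<Sum>j | c j = c k. if j = k then 1 else 0)"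
            using k by (intro sum.cong) auto
          also have "\<dots> = 1"
            by simp
          finally show False
            using sum0[of k] False by (simp add: A_def)
        qed
      qed
      then show "x = 0"
        by (simp add: vec_eq_iff)
    qed
  qed
qed

section \<open>Counting sparse vectors for balanced blocks\<close>

text \<open>A block of size \<open>s\<close> allows \<open>s + 1\<close> independent choices:
  \<open>None\<close>, or \<open>Some\<close> position for its single one. Sending choices to
  vectors is injective, which suffices for a lower bound.\<close>

lemma card_block_sparse_ge:
  fixes c :: "'r::finite \<Rightarrow> nat"
  assumes c: "\<And>k. c k < d"
  shows "(\<Prod>i<d. card {k. c k = i} + 1) \<le> card (block_sparse c)"
proof -
  let ?P = "PiE {..<d} (\<lambda>i. insert None (Some ` {k. c k = i}))"
  define f :: "(nat \<Rightarrow> 'r option) \<Rightarrow> bit ^ 'r"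
    where "f p = (\<chi> k. if p (c k) = Some k then 1 else 0)" for p
  have f1: "f p $ k = 1 \<longleftrightarrow> p (c k) = Some k" for p k
    by (simp add: f_def)
  have "inj_on f ?P"
  proof (rule inj_onI)
    fix p q assume pq: "p \<in> ?P" "q \<in> ?P" "f p = f q"
    have eq: "p (c k) = Some k \<longleftrightarrow> q (c k) = Some k" for k
      using f1 pq(3) by metis
    show "p = q"
    proof (rule PiE_ext[OF pq(1,2)])
      fix i assume "i \<in> {..<d}"
      then have mem: "p i \<in> insert None (Some ` {k. c k = i})"
          "q i \<in> insert None (Some ` {k. c k = i})"
        using pq PiE_mem by blast+
      \<comment> \<open>A position chosen for block \<open>i\<close> lies in that block, so
        comparing at \<open>c k\<close> detects every choice.\<close>
      have "p i = Some k \<Longrightarrow> c k = i" "q i = Some k \<Longrightarrow> c k = i" for k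
        using mem by (simp_all add: image_iff)
      then have "p i = Some k \<longleftrightarrow> q i = Some k" for k
        using eq[of k] by blast
      then show "p i = q i"
        by (metis not_None_eq)
    qed
  qed
  moreover have "f ` ?P \<subseteq> block_sparse c"
  proof (rule image_subsetI)
    fix p
    have "k = l" if "c k = c l" "f p $ k = 1" "f p $ l = 1" for k l
    proof -
      have "Some k = Some l"
        using that(2,3) unfolding f1 that(1) by (rule trans[OF sym])
      then show ?thesis
        by simp
    qed
    then show "f p \<in> block_sparse c"
      unfolding block_sparse_def by blast
  qed
  ultimately have "card ?P \<le> card (block_sparse c)"
    by (simp add: card_inj_on_le)
  moreover have "card ?P = (\<Prod>i<d. card {k. c k = i} + 1)"
  proof -
    have "card (insert None (Some ` K)) = card K + 1" for K :: "'r set"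
      by (subst card_insert_disjoint) (auto simp: card_image)
    then show ?thesis
      by (simp only: card_PiE[OF finite_lessThan])
  qed
  ultimately show ?thesis
    by simp
qed

text \<open>The class contains \<open>t * d + i\<close> for all \<open>t < r div d\<close>, and for
  \<open>t = r div d\<close> as well when \<open>i < r mod d\<close>.\<close>

lemma card_residue_class_ge:
  fixes r d i :: nat
  assumes "i < d"
  shows "r div d + (if i < r mod d then 1 else 0) \<le> card {m. m < r \<and> m mod d = i}"
proof -
  let ?q = "r div d + (if i < r mod d then 1 else 0)"
  have r: "r = d * (r div d) + r mod d"
    by simp
  have "t * d + i < r" if "t < ?q" for t
  proof (cases "t < r div d")
    case True
    then have "Suc t * d \<le> r div d * d"
      by (intro mult_le_mono1) simp
    also have "\<dots> \<le> r"
      by simp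
    finally show ?thesis
      using assms by simp
  next
    case False
    then have "t = r div d" "i < r mod d"
      using that by (auto split: if_splits)
    then show ?thesis
      using r by (metis add_less_cancel_left mult.commute)
  qed
  then have "(\<lambda>t. t * d + i) ` {..<?q} \<subseteq> {m. m < r \<and> m mod d = i}"
    using assms by auto
  moreover have "inj_on (\<lambda>t. t * d + i) {..<?q}"
    using assms by (auto intro!: inj_onI)
  ultimately have "card {..<?q} \<le> card {m. m < r \<and> m mod d = i}"
    by (intro card_inj_on_le) auto
  then show ?thesis
    by simp
qed

lemma max_non_blocking_ge:
  assumes d: "2 \<le> d" "d \<le> CARD('r::finite)"
  shows "(CARD('r) div d + 1) ^ (d - CARD('r) mod d) * (CARD('r) div d + 2) ^ (CARD('r) mod d)
    \<le> \<beta> TYPE('r) d"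
proof -
  define q \<rho> where "q = CARD('r) div d" and "\<rho> = CARD('r) mod d"
  have \<rho>: "\<rho> < d"
    using d by (simp add: \<rho>_def)
  \<comment> \<open>An arbitrary numbering of the coordinates lets residues modulo \<open>d\<close>
    serve as block labels of nearly equal frequency.\<close>
  obtain g where g: "bij_betw g (UNIV :: 'r set) {0..<CARD('r)}"
    using ex_bij_betw_finite_nat[of "UNIV :: 'r set"] by auto
  define c where "c k = g k mod d" for k
  have c: "c k < d" for k
    using d by (simp add: c_def)
  have card: "card {k. c k = i} = card {m. m < CARD('r) \<and> m mod d = i}" for i
  proof (rule bij_betw_same_card)
    have "g ` {k. c k = i} = {m. m < CARD('r) \<and> m mod d = i}"
    proof (intro set_eqI iffI)
      fix m assume m: "m \<in> {m. m < CARD('r) \<and> m mod d = i}"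
      then have "m \<in> range g"
        using g by (simp add: bij_betw_def)
      then show "m \<in> g ` {k. c k = i}"
        using m by (auto simp: c_def)
    qed (use g in \<open>auto simp: c_def bij_betw_def\<close>)
    then show "bij_betw g {k. c k = i} {m. m < CARD('r) \<and> m mod d = i}"
      using g by (auto simp: bij_betw_def intro: inj_on_subset)
  qed
  have "{..<d} \<inter> {i. i < \<rho>} = {..<\<rho>}" "{..<d} \<inter> - {i. i < \<rho>} = {\<rho>..<d}"
    using \<rho> by auto
  then have "(\<Prod>i<d. if i < \<rho> then q + 2 else q + 1) = (q + 2) ^ \<rho> * (q + 1) ^ (d - \<rho>)"
    by (subst prod.If_cases) (auto simp only: prod_constant finite_lessThan card_lessThan card_atLeastLessThan)
  then have "(q + 1) ^ (d - \<rho>) * (q + 2) ^ \<rho> = (\<Prod>i<d. if i < \<rho> then q + 2 else q + 1)"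
    by (simp only: mult.commute)
  also have "\<dots> \<le> (\<Prod>i<d. card {k. c k = i} + 1)"
  proof (rule prod_mono)
    fix i assume "i \<in> {..<d}"
    then show "0 \<le> (if i < \<rho> then q + 2 else q + 1) \<and>
        (if i < \<rho> then q + 2 else q + 1) \<le> card {k. c k = i} + 1"
      using card_residue_class_ge[of i d "CARD('r)"] by (auto simp: card q_def \<rho>_def)
  qed
  also have "\<dots> \<le> card (block_sparse c)"
    using c by (rule card_block_sparse_ge)
  also have "\<dots> \<le> \<beta> TYPE('r) d"
    using c d by (intro card_le_max_non_blocking non_blocking_block_sparse)
  finally show ?thesis
    by (simp add: q_def \<rho>_def)
qed

theorem theorem8:
  fixes r d \<rho> :: nat
  assumes "r = CARD('r::finite)"
    and "r \<ge> d" and "d \<ge> 2"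
    and "\<rho> = r mod d"
  shows "\<beta> TYPE('r) d \<ge> (r div d + 1) ^ (d - \<rho>) * (r div d + 2) ^ \<rho>
    \<and> real (\<beta> TYPE('r) d) > (real r / real d) ^ d
    \<and> (real d \<ge> real r / 2 \<longrightarrow> real (\<beta> TYPE('r) d) \<ge> (3 / 2) ^ r * (4 / 3) ^ d)"
proof (intro conjI impI)
  define q where "q = r div d"
  have \<rho>: "\<rho> < d" and r: "r = d * q + \<rho>"
    using assms by (simp_all add: q_def)
  show *: "\<beta> TYPE('r) d \<ge> (r div d + 1) ^ (d - \<rho>) * (r div d + 2) ^ \<rho>"
    using max_non_blocking_ge[where 'r = 'r, of d] assms by simp
  then have bound: "real ((q + 1) ^ (d - \<rho>) * (q + 2) ^ \<rho>) \<le> real (\<beta> TYPE('r) d)"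
    unfolding q_def of_nat_le_iff .
  \<comment> \<open>Strictness of the second bound comes from \<open>\<rho> < d\<close>.\<close>
  have "real r < real (d * (q + 1))"
    using r \<rho> by (subst of_nat_less_iff) simp
  then have "real r / real d < real (q + 1)"
    using assms(3) by (simp add: field_simps)
  then have "(real r / real d) ^ d < real (q + 1) ^ d"
    using assms(3) by (intro power_strict_mono) auto
  also have "\<dots> = real ((q + 1) ^ (d - \<rho>) * (q + 1) ^ \<rho>)"
    using \<rho> by (simp flip: power_add)
  also have "\<dots> \<le> real ((q + 1) ^ (d - \<rho>) * (q + 2) ^ \<rho>)"
    by (subst of_nat_le_iff) (intro mult_le_mono2 power_mono, auto)
  also note bound
  finally show "(real r / real d) ^ d < real (\<beta> TYPE('r) d)" .

  assume "real r / 2 \<le> real d"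
  then have "r \<le> 2 * d"
    by linarith
  \<comment> \<open>Equality holds throughout this range: for \<open>r = 2 * d\<close> both sides
    are \<open>3 ^ d\<close>, and otherwise \<open>q = 1\<close>.\<close>
  have "(3 / 2) ^ r * (4 / 3) ^ d = real ((q + 1) ^ (d - \<rho>) * (q + 2) ^ \<rho>)"
  proof (cases "r = 2 * d")
    case True
    then have "q = 2" "\<rho> = 0"
      using assms by (simp_all add: q_def)
    then show ?thesis
      using True by (simp add: power_mult power2_eq_square flip: power_mult_distrib)
  next
    case False
    then have "q = 1"
      using \<open>r \<le> 2 * d\<close> assms(2,3) unfolding q_def by (intro div_nat_eqI) auto
    then have r': "r = d + \<rho>"
      using r by simp
    obtain e where e: "d = e + \<rho>"
      using \<rho> by (metis less_imp_add_positive add.commute)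
    \<comment> \<open>Here \<open>r = e + 2 * \<rho>\<close>: the \<open>e\<close> blocks of size 1
      contribute 2 = (3/2)(4/3) each, the \<open>\<rho>\<close> blocks of size 2 contribute 3 =
      (3/2)^2 (4/3) each.\<close>
    have "(3 / 2 :: real) ^ r * (4 / 3) ^ d = ((3 / 2) * (4 / 3)) ^ e * ((3 / 2) ^ 2 * (4 / 3)) ^ \<rho>"
      unfolding r' e power_mult_distrib power_add power2_eq_square by simp
    also have "\<dots> = 2 ^ e * 3 ^ \<rho>"
      by (simp add: power2_eq_square)
    finally show ?thesis
      using \<open>q = 1\<close> e by simp
  qed
  with bound show "(3 / 2) ^ r * (4 / 3) ^ d \<le> real (\<beta> TYPE('r) d)"
    by simp
qed

end
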